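(* Let $q$ be a prime power, $0\le k\le n$ integers, and $V$ an $n$-dimensional $\mathbb F_q$-vector space with a fixed basis. Then $$\left[\begin{matrix} n\\k\end{matrix}\right]_{q,t}=\sum_U t^{s(U)},$$ where the sum runs over all $k$-dimensional $\mathbb F_q$-subspaces $U$ of $V$.
   Context: $(q,t)$-binomial: $\left[\begin{smallmatrix} n\\k\end{smallmatrix}\right]_{q,t}:=\prod_{i=1}^k\frac{1-t^{q^n-q^{i-1}}}{1-t^{q^k-q^{i-1}}}$, a rational function of the variable $t$. Statistic $s(U)$: relative to the fixed basis, a $k$-dimensional subspace $U$ of $V\cong\mathbb F_q^n$ is the row space of a unique $k\times n$ matrix $A=(a_{ij})$ in the following row-reduced echelon form: there are pivot columns $c_1>c_2>\cdots>c_k$ such that the $i$-th row has entry $1$ in column $c_i$, entries $0$ in all columns $j>c_i$, and entries $0$ in all the other pivot columns. The parametrization positions of $U$ are the pairs $(i,j)$ with $1\le i\le k$, $j<c_i$ and $j$ not a pivot column (the entries there are arbitrary elements of $\mathbb F_q$). Fix bijections $\phi_0:\mathbb F_q\to\{0,1,\ldots,q-1\}$ and $\phi_1:\mathbb F_q\to\{1,2,\ldots,q\}$. For a parametrization position $(i,j)$ let $\mathrm v_U(a_{ij})=\phi_1(a_{ij})$ if $(i,j)$ is the lowest parametrization position in its column (i.e. the one with largest row index $i$), and $\mathrm v_U(a_{ij})=\phi_0(a_{ij})$ otherwise. Let $$\mathrm d_U(i,j):=k-i+j-|\{\text{pivot columns left of column }j\}|-1,\qquad s(U):=\sum_{(i,j)}\mathrm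 v_U(a_{ij})\left(q^{i+\mathrm d_U(i,j)}-q^{\mathrm d_U(i,j)}\right),$$ the sum being over all parametrization positions $(i,j)$ of $U$. *)

theory Defs
  imports
    Complex_Main
    "HOL-Library.Cardinality"
    "HOL-Computational_Algebra.Polynomial"
    "HOL-Computational_Algebra.Fraction_Field"
begin

definition tvar :: "rat poly fract" where
  "tvar = Fract [:0, 1:] 1"

(* All exponents are genuine (non-truncated) differences when 1 <= i <= k <= n. *)
definition qt_binomial :: "nat \<Rightarrow> nat \<Rightarrow> nat \<Rightarrow> rat poly fract" where
  "qt_binomial q n k =
     (\<Prod>i = 1..k. (1 - tvar ^ (q ^ n - q ^ (i - 1))) / (1 - tvar ^ (q ^ k - q ^ (i - 1))))"

(* A k x n matrix is a function A with entries A i j for 1 <= i <= k and 1 <= j <= n, and 0 for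
   all other indices. Its row space is formed with respect to the basis b 1, ..., b n of V. *)
definition row_space ::
  "('a::field \<Rightarrow> 'v::ab_group_add \<Rightarrow> 'v) \<Rightarrow> (nat \<Rightarrow> 'v) \<Rightarrow> nat \<Rightarrow> nat \<Rightarrow> (nat \<Rightarrow> nat \<Rightarrow> 'a) \<Rightarrow> 'v set"
where
  "row_space scale b k n A =
     module.span scale ((\<lambda>i. \<Sum>j = 1..n. scale (A i j) (b j)) ` {1..k})"

(* c i is the pivot column of row i. The two conventions on values outside the index ranges
   ensure that c and A are unique as total functions. *)
definition is_echelon :: "nat \<Rightarrow> nat \<Rightarrow> (nat \<Rightarrow> nat) \<Rightarrow> (nat \<Rightarrow> nat \<Rightarrow> 'a::field) \<Rightarrow> bool" where
  "is_echelon k n c A \<longleftrightarrow>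
     (\<forall>i j. \<not> (i \<in> {1..k} \<and> j \<in> {1..n}) \<longrightarrow> A i j = 0) \<and>
     (\<forall>i. i \<notin> {1..k} \<longrightarrow> c i = 0) \<and>
     (\<forall>i\<in>{1..k}. c i \<in> {1..n}) \<and>
     (\<forall>i\<in>{1..k}. \<forall>i'\<in>{1..k}. i < i' \<longrightarrow> c i > c i') \<and>
     (\<forall>i\<in>{1..k}. A i (c i) = 1 \<and>
        (\<forall>j\<in>{1..n}. j > c i \<longrightarrow> A i j = 0) \<and>
        (\<forall>i'\<in>{1..k}. i' \<noteq> i \<longrightarrow> A i (c i') = 0))"

definition echelon_form ::
  "('a::field \<Rightarrow> 'v::ab_group_add \<Rightarrow> 'v) \<Rightarrow> (nat \<Rightarrow> 'v) \<Rightarrow> nat \<Rightarrow> nat \<Rightarrow> 'v set \<Rightarrow>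
     (nat \<Rightarrow> nat) \<times> (nat \<Rightarrow> nat \<Rightarrow> 'a)"
where
  "echelon_form scale b k n U =
     (THE (c, A). is_echelon k n c A \<and> row_space scale b k n A = U)"

definition param_positions :: "nat \<Rightarrow> (nat \<Rightarrow> nat) \<Rightarrow> (nat \<times> nat) set" where
  "param_positions k c = {(i, j). i \<in> {1..k} \<and> 1 \<le> j \<and> j < c i \<and> j \<notin> c ` {1..k}}"

definition entry_value ::
  "('a \<Rightarrow> nat) \<Rightarrow> ('a \<Rightarrow> nat) \<Rightarrow> nat \<Rightarrow> (nat \<Rightarrow> nat) \<Rightarrow> (nat \<Rightarrow> nat \<Rightarrow> 'a) \<Rightarrow> nat \<Rightarrow> nat \<Rightarrow> nat"
where
  "entry_value \<phi>0 \<phi>1 k c A i j =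
     (if \<forall>i'. (i', j) \<in> param_positions k c \<longrightarrow> i' \<le> i then \<phi>1 (A i j) else \<phi>0 (A i j))"

(* On parametrization positions no subtraction is truncated: i <= k, and at most j - 1 pivot
   columns lie left of column j. *)
definition d_stat :: "nat \<Rightarrow> (nat \<Rightarrow> nat) \<Rightarrow> nat \<Rightarrow> nat \<Rightarrow> nat" where
  "d_stat k c i j = k - i + j - card {p \<in> c ` {1..k}. p < j} - 1"

definition s_stat ::
  "('a::{field,finite} \<Rightarrow> 'v::ab_group_add \<Rightarrow> 'v) \<Rightarrow> (nat \<Rightarrow> 'v) \<Rightarrow>
     ('a \<Rightarrow> nat) \<Rightarrow> ('a \<Rightarrow> nat) \<Rightarrow> nat \<Rightarrow> nat \<Rightarrow> 'v set \<Rightarrow> nat"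
where
  "s_stat scale b \<phi>0 \<phi>1 k n U =
     (let q = CARD('a); (c, A) = echelon_form scale b k n U in
      \<Sum>(i, j)\<in>param_positions k c.
        entry_value \<phi>0 \<phi>1 k c A i j * (q ^ (i + d_stat k c i j) - q ^ d_stat k c i j))"

end

theory Submission
  imports Defs "HOL-Library.FuncSet"
begin

text \<open>The expansion rests on one recursion, which both sides satisfy and which replaces \<open>t\<close> by
\<open>t ^ q\<close>. For this reason \<open>t\<close> is allowed to be any element \<open>x\<close> of a field with no positive power
equal to 1; the theorem is the case of the variable of the field of rational functions.

On the algebraic side, the factor for \<open>i = 1\<close> in the numerator of the \<open>(q,t)\<close>-binomial splits as
\<open>1 - x ^ (q^n - 1) = (1 - x ^ (q^k - 1)) + x ^ (q^k - 1) * (1 - x ^ (q^n - q^k))\<close>.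
All other factors are those of a \<open>(q,t)\<close>-binomial with \<open>n - 1\<close> in place of \<open>n\<close> and \<open>x ^ q\<close> in
place of \<open>x\<close>, because \<open>q^n - q^i = q * (q^(n-1) - q^(i-1))\<close>. The first summand hence contributes
the binomial for \<open>n - 1\<close> and \<open>k - 1\<close>, and the second one the binomial for \<open>n - 1\<close> and \<open>k\<close>, times
\<open>x ^ (q^k - 1)\<close> and times the quotient of two denominators, which is a product of geometric sums
with \<open>q\<close> terms each (\<open>qt_binomial_at_Suc_Suc\<close>).

On the combinatorial side, a subspace is the same thing as a reduced echelon matrix
(\<open>bij_betw_row_space\<close>), and the first column of such a matrix is deleted. If that column is the
pivot column of the last row, then it holds no parameter, and the last row, which holds none
either, disappears with it. If it is not a pivot column, then it consists of \<open>k\<close> free parameters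
with \<open>d = k - i\<close> in row \<open>i\<close>. In both cases every exponent \<open>d\<close> outside the deleted column drops by
one; the contribution of the other columns to the statistic is thus \<open>q\<close> times the statistic of the
smaller matrix, which again means \<open>x ^ q\<close> in place of \<open>x\<close>. Summed over the entry of a free column in
row \<open>i\<close>, the powers of \<open>x\<close> give a geometric sum with \<open>q\<close> terms and ratio \<open>x ^ (q^k - q^(k-i))\<close>. It starts
at exponent 0 for \<open>i < k\<close> and at exponent 1 for the lowest position \<open>i = k\<close>, and this is where
the factor \<open>x ^ (q^k - 1)\<close> comes from. So the two cases give the two summands of the recursion
(\<open>echelon_gf_Suc_Suc\<close>, \<open>free_column_product\<close>).\<close>

(* Row and column indices start at 1, so the literal is kept as a numeral in simplification. *)
declare One_nat_def [simp del]

section \<open>Reduced echelon matrices\<close>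

lemma echelon_outside:
  assumes "is_echelon k n c A" "\<not> (i \<in> {1..k} \<and> j \<in> {1..n})"
  shows "A i j = 0"
proof -
  have "\<forall>i j. \<not> (i \<in> {1..k} \<and> j \<in> {1..n}) \<longrightarrow> A i j = 0"
    using assms(1) unfolding is_echelon_def by (rule conjunct1)
  then show ?thesis
    using assms(2) by blast
qed

text \<open>Working rules for the defining conjunction. Entries to the right of a pivot vanish at every index,
also beyond the last column, since all entries outside the matrix are 0.\<close>

lemma echelonI:
  assumes "\<And>i j. \<not> (i \<in> {1..k} \<and> j \<in> {1..n}) \<Longrightarrow> A i j = 0"
    and "\<And>i. i \<notin> {1..k} \<Longrightarrow> c i = 0"
    and "\<And>i. i \<in> {1..k} \<Longrightarrow> 1 \<le> c i" and "\<And>i. i \<in> {1..k} \<Longrightarrow> c i \<le> n"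
    and "\<And>i i'. i \<in> {1..k} \<Longrightarrow> i' \<in> {1..k} \<Longrightarrow> i < i' \<Longrightarrow> c i' < c i"
    and "\<And>i. i \<in> {1..k} \<Longrightarrow> A i (c i) = 1"
    and "\<And>i j. i \<in> {1..k} \<Longrightarrow> c i < j \<Longrightarrow> A i j = 0"
    and "\<And>i i'. i \<in> {1..k} \<Longrightarrow> i' \<in> {1..k} \<Longrightarrow> i' \<noteq> i \<Longrightarrow> A i (c i') = 0"
  shows "is_echelon k n c A"
  unfolding is_echelon_def
  by (intro conjI allI ballI impI; (rule assms; assumption)?) (simp add: assms(3,4))

lemma echelonD:
  assumes "is_echelon k n c A"
  shows "i \<notin> {1..k} \<Longrightarrow> c i = 0"
    and "i \<in> {1..k} \<Longrightarrow> 1 \<le> c i" and "i \<in> {1..k} \<Longrightarrow> c i \<le> n"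
    and "i \<in> {1..k} \<Longrightarrow> i' \<in> {1..k} \<Longrightarrow> i < i' \<Longrightarrow> c i' < c i"
    and "i \<in> {1..k} \<Longrightarrow> A i (c i) = 1"
    and "i \<in> {1..k} \<Longrightarrow> c i < j \<Longrightarrow> A i j = 0"
    and "i \<in> {1..k} \<Longrightarrow> i' \<in> {1..k} \<Longrightarrow> i' \<noteq> i \<Longrightarrow> A i (c i') = 0"
proof -
  note D = assms[unfolded is_echelon_def]
  show "i \<notin> {1..k} \<Longrightarrow> c i = 0"
    using D[THEN conjunct2, THEN conjunct1] by blast
  have range: "i \<in> {1..k} \<Longrightarrow> c i \<in> {1..n}" for i
    using D[THEN conjunct2, THEN conjunct2, THEN conjunct1] by blast
  then show "i \<in> {1..k} \<Longrightarrow> 1 \<le> c i" and "i \<in> {1..k} \<Longrightarrow> c i \<le> n" for i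
    by (meson atLeastAtMost_iff)+
  show "i \<in> {1..k} \<Longrightarrow> i' \<in> {1..k} \<Longrightarrow> i < i' \<Longrightarrow> c i' < c i"
    using D[THEN conjunct2, THEN conjunct2, THEN conjunct2, THEN conjunct1] by blast
  have row: "i \<in> {1..k} \<Longrightarrow> A i (c i) = 1 \<and> (\<forall>j\<in>{1..n}. j > c i \<longrightarrow> A i j = 0) \<and>
        (\<forall>i'\<in>{1..k}. i' \<noteq> i \<longrightarrow> A i (c i') = 0)" for i
    using D[THEN conjunct2, THEN conjunct2, THEN conjunct2, THEN conjunct2] by blast
  then show "i \<in> {1..k} \<Longrightarrow> A i (c i) = 1"
    and "i \<in> {1..k} \<Longrightarrow> i' \<in> {1..k} \<Longrightarrow> i' \<noteq> i \<Longrightarrow> A i (c i') = 0"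
    by blast+
  show "i \<in> {1..k} \<Longrightarrow> c i < j \<Longrightarrow> A i j = 0"
    using row[of i] echelon_outside[OF assms, of i j] by blast
qed

definition echelons :: "nat \<Rightarrow> nat \<Rightarrow> ((nat \<Rightarrow> nat) \<times> (nat \<Rightarrow> nat \<Rightarrow> 'a::field)) set" where
  "echelons k n = {(c, A). is_echelon k n c A}"

text \<open>Both components of an echelon matrix are functions that vanish outside a finite set and take only
finitely many values on it.\<close>

lemma finite_echelons:
  "finite (echelons k n :: ((nat \<Rightarrow> nat) \<times> (nat \<Rightarrow> nat \<Rightarrow> 'a::{field,finite})) set)"
proof -
  define C where "C = {c. \<forall>i. (i \<in> {1..k} \<longrightarrow> c i \<in> {..n}) \<and> (i \<notin> {1..k} \<longrightarrow> c i = 0)}"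
  define R where "R = {r :: nat \<Rightarrow> 'a. \<forall>j. (j \<in> {1..n} \<longrightarrow> r j \<in> UNIV) \<and> (j \<notin> {1..n} \<longrightarrow> r j = 0)}"
  define M where "M = {A. \<forall>i. (i \<in> {1..k} \<longrightarrow> A i \<in> R) \<and> (i \<notin> {1..k} \<longrightarrow> A i = (\<lambda>_. 0))}"
  have "finite C" "finite R"
    unfolding C_def R_def by (rule finite_set_of_finite_funs; simp)+
  then have "finite M"
    unfolding M_def by (intro finite_set_of_finite_funs) simp_all
  moreover have "echelons k n \<subseteq> C \<times> M"
  proof (clarsimp simp only: echelons_def mem_Collect_eq case_prod_conv mem_Times_iff fst_conv snd_conv)
    fix c :: "nat \<Rightarrow> nat" and A :: "nat \<Rightarrow> nat \<Rightarrow> 'a"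
    assume E: "is_echelon k n c A"
    have "c \<in> C"
      unfolding C_def using echelonD(1,3)[OF E] by blast
    moreover have "A \<in> M"
      unfolding M_def R_def using echelon_outside[OF E] by blast
    ultimately show "c \<in> C \<and> A \<in> M" ..
  qed
  ultimately show ?thesis
    using \<open>finite C\<close> finite_subset by blast
qed

text \<open>The index \<open>i\<close> is recovered from the value \<open>c i\<close> and the image: exactly \<open>i - 1\<close> elements of the image
exceed \<open>c i\<close>.\<close>

lemma decreasing_enumeration_unique:
  fixes c c' :: "nat \<Rightarrow> 'b::linorder"
  assumes dec: "\<And>i i'. i \<in> {1..k} \<Longrightarrow> i' \<in> {1..k} \<Longrightarrow> i < i' \<Longrightarrow> c i > c i'"
    and dec': "\<And>i i'. i \<in> {1..k} \<Longrightarrow> i' \<in> {1..k} \<Longrightarrow> i < i' \<Longrightarrow> c' i > c' i'"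
    and img: "c ` {1..k} = c' ` {1..k}" and i: "i \<in> {1..k}"
  shows "c i = c' i"
proof -
  have rank: "card {x \<in> d ` {1..k}. x > d i} = i - 1"
    if d: "\<And>i i'. i \<in> {1..k} \<Longrightarrow> i' \<in> {1..k} \<Longrightarrow> i < i' \<Longrightarrow> d i > d i'" and i: "i \<in> {1..k}"
    for d :: "nat \<Rightarrow> 'b" and i
  proof -
    have "{x \<in> d ` {1..k}. x > d i} = d ` {1..<i}"
    proof -
      have "i' < i" if "i' \<in> {1..k}" "d i' > d i" for i'
        using d[of i i'] that i by (metis less_asym linorder_neqE_nat)
      then show ?thesis
        using d i by fastforce
    qed
    moreover have "inj_on d {1..<i}"
    proof (rule linorder_inj_onI')
      fix x y assume "x \<in> {1..<i}" "y \<in> {1..<i}" "x < y"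
      then show "d x \<noteq> d y"
        using d[of x y] i by simp
    qed
    ultimately show ?thesis
      by (simp add: card_image)
  qed
  obtain i' where i': "i' \<in> {1..k}" "c i = c' i'"
    using img i by (metis imageE imageI)
  have "i - 1 = i' - 1"
    using rank[of c, OF dec i] rank[of c', OF dec' i'(1)] img i'(2) by simp
  then have "i = i'"
    using i i' by auto
  then show ?thesis
    using i' by simp
qed

section \<open>Subspaces and reduced echelon matrices\<close>

locale ordered_basis = vector_space scale
  for scale :: "'a::field \<Rightarrow> 'v::ab_group_add \<Rightarrow> 'v" (infixr "*s" 75) +
  fixes b :: "nat \<Rightarrow> 'v" and n :: nat
  assumes inj_b: "inj_on b {1..n}"
    and indep_b: "independent (b ` {1..n})"
    and span_b: "span (b ` {1..n}) = UNIV"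
begin

text \<open>The coordinates with respect to the basis are extended by 0 to all natural numbers, just as
the entries of an echelon matrix are.\<close>

definition coord :: "'v \<Rightarrow> nat \<Rightarrow> 'a" where
  "coord v j = (if j \<in> {1..n} then representation (b ` {1..n}) v (b j) else 0)"

definition combination :: "(nat \<Rightarrow> 'a) \<Rightarrow> 'v" where
  "combination f = (\<Sum>j = 1..n. f j *s b j)"

text \<open>The row-reduced form has its pivots at the right end of the rows, so the leading coordinate is the
last nonzero one. The leading positions of a subspace are its pivot columns; they are defined
without reference to any matrix, and this is what makes the pivots unique.\<close>

definition leads :: "'v \<Rightarrow> nat \<Rightarrow> bool" where
  "leads v p \<longleftrightarrow> coord v p \<noteq> 0 \<and> (\<forall>j>p. coord v j = 0)"

definition leading_positions :: "'v set \<Rightarrow> nat set" where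
  "leading_positions U = {p. \<exists>u\<in>U. leads u p}"

lemma coord_outside: "j \<notin> {1..n} \<Longrightarrow> coord v j = 0"
  unfolding coord_def by (rule if_not_P)

lemma coord_nonzeroD: "coord v j \<noteq> 0 \<Longrightarrow> j \<in> {1..n}"
  using coord_outside by blast

lemma coord_diff: "coord (u - v) j = coord u j - coord v j"
  by (cases "j \<in> {1..n}")
    (simp add: coord_def representation_diff indep_b span_b,
     simp add: coord_outside del: atLeastAtMost_iff)

lemma coord_scale: "coord (a *s v) j = a * coord v j"
  by (cases "j \<in> {1..n}")
    (simp add: coord_def representation_scale indep_b span_b,
     simp add: coord_outside del: atLeastAtMost_iff)

lemma coord_sum: "coord (\<Sum>i\<in>I. f i) j = (\<Sum>i\<in>I. coord (f i) j)"
  by (cases "j \<in> {1..n}")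
    (simp add: coord_def representation_sum indep_b span_b,
     simp add: coord_outside del: atLeastAtMost_iff)

lemma coord_combination:
  assumes "j \<in> {1..n}"
  shows "coord (combination f) j = f j"
proof -
  have basis: "coord (b i) j = (if i = j then 1 else 0)" if "i \<in> {1..n}" for i
  proof -
    have "coord (b i) j = representation (b ` {1..n}) (b i) (b j)"
      using assms by (simp add: coord_def del: atLeastAtMost_iff)
    also have "\<dots> = (if b j = b i then 1 else 0)"
      using that by (subst representation_basis[OF indep_b]) auto
    also have "\<dots> = (if i = j then 1 else 0)"
      using inj_on_eq_iff[OF inj_b that assms] by metis
    finally show ?thesis .
  qed
  have "coord (combination f) j = (\<Sum>i = 1..n. f i * coord (b i) j)"
    by (simp add: combination_def coord_sum coord_scale)
  also have "\<dots> = (\<Sum>i = 1..n. if i = j then f i else 0)"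
    by (intro sum.cong) (auto simp: basis)
  also have "\<dots> = f j"
    using assms by simp
  finally show ?thesis .
qed

lemma combination_coord: "combination (coord v) = v"
proof -
  have "combination (coord v) = (\<Sum>j = 1..n. representation (b ` {1..n}) v (b j) *s b j)"
    by (simp add: combination_def coord_def)
  also have "\<dots> = (\<Sum>x \<in> b ` {1..n}. representation (b ` {1..n}) v x *s x)"
    by (simp add: sum.reindex inj_b)
  also have "\<dots> = v"
    by (rule sum_representation_eq) (auto simp: indep_b span_b)
  finally show ?thesis .
qed

lemma coord_eqI: "(\<And>j. coord u j = coord v j) \<Longrightarrow> u = v"
  by (metis combination_coord ext)

lemma nonzero_leads:
  assumes "v \<noteq> 0"
  shows "\<exists>p. leads v p"
proof -
  let ?S = "{j. coord v j \<noteq> 0}"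
  have fin: "finite ?S"
    by (rule finite_subset[of _ "{1..n}"]) (use coord_nonzeroD in auto)
  have "?S \<noteq> {}"
    using assms coord_eqI[of v 0] coord_diff[of v v] by auto
  then have "leads v (Max ?S)"
    using Max_in[OF fin] Max_ge[OF fin] by (force simp: leads_def)
  then show ?thesis ..
qed

lemma finite_leading_positions: "finite (leading_positions U)"
  by (rule finite_subset[of _ "{1..n}"])
    (use coord_nonzeroD in \<open>auto simp: leading_positions_def leads_def\<close>)

text \<open>A vector is determined within \<open>U\<close> by its coordinates at the pivots: the difference of two vectors
that agree there lies in \<open>U\<close>, and if it were nonzero, it would lead at a pivot.\<close>

lemma eq_if_coord_leading_eq:
  assumes "subspace U" "u \<in> U" "v \<in> U"
    and "\<And>p. p \<in> leading_positions U \<Longrightarrow> coord u p = coord v p"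
  shows "u = v"
proof (rule ccontr)
  assume "u \<noteq> v"
  then obtain p where p: "leads (u - v) p"
    using nonzero_leads[of "u - v"] by auto
  then have "p \<in> leading_positions U"
    using subspace_diff[OF assms(1-3)] by (auto simp: leading_positions_def)
  then show False
    using p assms(4) by (auto simp: leads_def coord_diff)
qed

text \<open>Gaussian elimination for one row: a vector that leads at \<open>p\<close> is normalized, and its coordinates at
the smaller pivots are cleared with the reduced vectors that exist there by induction. Those have
no coordinates above their own pivot, so nothing from \<open>p\<close> upwards changes.\<close>

lemma ex_reduced_vector:
  assumes "subspace U" "p \<in> leading_positions U"
  shows "\<exists>u\<in>U. coord u p = 1 \<and> (\<forall>j>p. coord u j = 0) \<and>
           (\<forall>p' \<in> leading_positions U. p' \<noteq> p \<longrightarrow> coord u p' = 0)"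
  using assms(2)
proof (induction p rule: less_induct)
  case (less p)
  let ?P = "{p' \<in> leading_positions U. p' < p}"
  from less.IH have "\<forall>p'\<in>?P. \<exists>u\<in>U. coord u p' = 1 \<and> (\<forall>j>p'. coord u j = 0) \<and>
           (\<forall>p'' \<in> leading_positions U. p'' \<noteq> p' \<longrightarrow> coord u p'' = 0)"
    by blast
  then obtain w where w: "\<And>p'. p' \<in> ?P \<Longrightarrow> w p' \<in> U \<and> coord (w p') p' = 1 \<and>
      (\<forall>j>p'. coord (w p') j = 0) \<and>
      (\<forall>p'' \<in> leading_positions U. p'' \<noteq> p' \<longrightarrow> coord (w p') p'' = 0)"
    by (metis (no_types, lifting))
  obtain u0 where u0: "u0 \<in> U" "leads u0 p"
    using less.prems by (auto simp: leading_positions_def)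
  define u1 where "u1 = inverse (coord u0 p) *s u0"
  have u1: "u1 \<in> U" "coord u1 p = 1" "\<And>j. j > p \<Longrightarrow> coord u1 j = 0"
    using u0 subspace_scale[OF assms(1)] by (auto simp: u1_def coord_scale leads_def)
  define u where "u = u1 - (\<Sum>p'\<in>?P. coord u1 p' *s w p')"
  have fin: "finite ?P"
    using finite_leading_positions by simp
  have coord_u: "coord u j = coord u1 j - (\<Sum>p'\<in>?P. coord u1 p' * coord (w p') j)" for j
    by (simp add: u_def coord_diff coord_sum coord_scale)
  have above: "coord u j = coord u1 j" if "j \<ge> p" for j
    unfolding coord_u using w that by (simp add: sum.neutral)
  have "u \<in> U"
    unfolding u_def using w
    by (intro subspace_diff[OF assms(1)] u1(1) subspace_sum[OF assms(1)]
        subspace_scale[OF assms(1)]) blast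
  moreover have "coord u p' = 0" if "p' \<in> leading_positions U" "p' \<noteq> p" for p'
  proof (cases "p' < p")
    case True
    then have "(\<Sum>x\<in>?P. coord u1 x * coord (w x) p') =
        (\<Sum>x\<in>?P. if x = p' then coord u1 x else 0)"
      using that w by (intro sum.cong) auto
    then show ?thesis
      using True that fin by (simp add: coord_u)
  next
    case False
    then show ?thesis
      using that above u1(3) by simp
  qed
  ultimately show ?case
    using above u1 by (intro bexI[of _ u]) auto
qed

lemma row_space_eq: "row_space scale b k n A = span ((\<lambda>i. combination (A i)) ` {1..k})"
  by (simp add: row_space_def combination_def)

context
  fixes k :: nat and c :: "nat \<Rightarrow> nat" and A :: "nat \<Rightarrow> nat \<Rightarrow> 'a"
  assumes ech: "is_echelon k n c A"
begin

lemma echelon_coord_row: "coord (combination (A i)) j = A i j"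
  using ech by (cases "j \<in> {1..n}") (auto simp: coord_combination coord_outside is_echelon_def)

lemma echelon_pivot_coord:
  "i \<in> {1..k} \<Longrightarrow> i' \<in> {1..k} \<Longrightarrow> A i (c i') = (if i = i' then 1 else 0)"
  using ech by (auto simp: is_echelon_def)

lemma echelon_coord_sum:
  assumes "i \<in> {1..k}"
  shows "coord (\<Sum>i' = 1..k. f i' *s combination (A i')) (c i) = f i"
proof -
  have "coord (\<Sum>i' = 1..k. f i' *s combination (A i')) (c i) = (\<Sum>i' = 1..k. f i' * A i' (c i))"
    by (simp add: coord_sum coord_scale echelon_coord_row)
  also have "\<dots> = (\<Sum>i' = 1..k. if i' = i then f i' else 0)"
    using assms by (intro sum.cong) (auto simp: echelon_pivot_coord)
  finally show ?thesis
    using assms by simp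
qed

lemma echelon_inj: "inj_on (\<lambda>i. combination (A i)) {1..k}"
proof (rule inj_onI)
  fix i i' assume "i \<in> {1..k}" "i' \<in> {1..k}" "combination (A i) = combination (A i')"
  then show "i = i'"
    using echelon_coord_row[of i "c i"] echelon_coord_row[of i' "c i"]
      echelon_pivot_coord[of i i] echelon_pivot_coord[of i' i] by (metis zero_neq_one)
qed

text \<open>The submatrix of the pivot columns is a unit matrix, so the coefficients of a vector of the row
space are its coordinates at the pivots. Independence of the rows and the description of the
leading positions both come from this.\<close>

lemma row_space_expansion:
  assumes "u \<in> row_space scale b k n A"
  shows "u = (\<Sum>i = 1..k. coord u (c i) *s combination (A i))"
proof -
  obtain g where g: "u = (\<Sum>x \<in> (\<lambda>i. combination (A i)) ` {1..k}. g x *s x)"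
    using assms by (auto simp: row_space_eq span_finite)
  then have g': "u = (\<Sum>i = 1..k. g (combination (A i)) *s combination (A i))"
    by (simp add: sum.reindex echelon_inj)
  have "coord u (c i) = g (combination (A i))" if "i \<in> {1..k}" for i
    unfolding g' by (rule echelon_coord_sum[OF that])
  then show ?thesis
    using g' by (metis (no_types, lifting) sum.cong)
qed

lemma echelon_independent: "independent ((\<lambda>i. combination (A i)) ` {1..k})"
proof (rule independent_if_scalars_zero)
  fix g x
  assume 0: "(\<Sum>x \<in> (\<lambda>i. combination (A i)) ` {1..k}. g x *s x) = 0"
    and "x \<in> (\<lambda>i. combination (A i)) ` {1..k}"
  then obtain i where i: "i \<in> {1..k}" "x = combination (A i)"
    by blast
  have "(\<Sum>i = 1..k. g (combination (A i)) *s combination (A i)) = 0"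
    using 0 by (simp add: sum.reindex echelon_inj)
  then show "g x = 0"
    using echelon_coord_sum[OF i(1), of "\<lambda>i. g (combination (A i))"] i(2)
      coord_scale[of 0 0 "c i"] by simp
qed simp

lemma dim_row_space: "dim (row_space scale b k n A) = k"
  using dim_span_eq_card_independent[OF echelon_independent] card_image[OF echelon_inj]
  by (simp add: row_space_eq)

lemma leading_positions_row_space:
  "leading_positions (row_space scale b k n A) = c ` {1..k}" (is "?L = ?R")
proof (intro equalityI subsetI)
  fix p assume "p \<in> ?L"
  then obtain u where u: "u \<in> row_space scale b k n A" "leads u p"
    by (auto simp: leading_positions_def)
  have coord_u: "coord u j = (\<Sum>i = 1..k. coord u (c i) * A i j)" for j
    using arg_cong[OF row_space_expansion[OF u(1)], of "\<lambda>v. coord v j"]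
    by (simp add: coord_sum coord_scale echelon_coord_row)
  from u(2) have "(\<Sum>i = 1..k. coord u (c i) * A i p) \<noteq> 0"
    unfolding coord_u[symmetric] by (simp add: leads_def)
  then obtain i where i: "i \<in> {1..k}" "coord u (c i) * A i p \<noteq> 0"
    by (rule sum.not_neutral_contains_not_neutral)
  have "c i \<le> p"
    using u(2) i(2) by (metis leads_def mult_zero_left not_le)
  moreover have "p \<le> c i"
  proof (rule ccontr)
    assume "\<not> p \<le> c i"
    then have "A i p = 0"
      using ech i(1) by (cases "p \<in> {1..n}") (auto simp: is_echelon_def)
    with i(2) show False
      by simp
  qed
  ultimately show "p \<in> ?R"
    using i(1) by auto
next
  fix p assume "p \<in> ?R"
  then obtain i where i: "i \<in> {1..k}" "p = c i"
    by blast
  have "A i j = 0" if "j > c i" for j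
    using ech i(1) that by (cases "j \<in> {1..n}") (auto simp: is_echelon_def)
  then have "leads (combination (A i)) p"
    using i by (auto simp: leads_def echelon_coord_row echelon_pivot_coord)
  moreover have "combination (A i) \<in> row_space scale b k n A"
    using i(1) by (auto simp: row_space_eq intro: span_base)
  ultimately show "p \<in> ?L"
    by (auto simp: leading_positions_def)
qed

end

text \<open>The row space determines the pivot set as its set of leading positions, and a decreasing enumeration
is determined by its image. Corresponding rows of the two matrices then lie in the same space and
have the same unit vector as coordinates at the pivots.\<close>

lemma echelon_unique:
  assumes ech: "is_echelon k n c A" "is_echelon k n c' A'"
    and eq: "row_space scale b k n A = row_space scale b k n A'"
  shows "c = c' \<and> A = A'"
proof
  have img: "c ` {1..k} = c' ` {1..k}"
    using leading_positions_row_space[OF ech(1)] leading_positions_row_space[OF ech(2)] eq by simp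
  have on: "c i = c' i" if "i \<in> {1..k}" for i
    by (rule decreasing_enumeration_unique[OF _ _ img that]) (use ech in \<open>auto simp: is_echelon_def\<close>)
  have off: "c i = c' i" if "i \<notin> {1..k}" for i
    using ech that unfolding is_echelon_def by metis
  show c: "c = c'"
    using on off by blast
  let ?U = "row_space scale b k n A"
  have sub: "subspace ?U"
    by (simp add: row_space_eq)
  have rows: "combination (A i) = combination (A' i)" if i: "i \<in> {1..k}" for i
  proof (rule eq_if_coord_leading_eq[OF sub])
    show "combination (A i) \<in> ?U"
      using i by (auto simp: row_space_eq intro: span_base)
    show "combination (A' i) \<in> ?U"
      unfolding eq using i by (auto simp: row_space_eq intro: span_base)
    fix p assume "p \<in> leading_positions ?U"
    then obtain i' where "i' \<in> {1..k}" "p = c i'"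
      using leading_positions_row_space[OF ech(1)] by auto
    then show "coord (combination (A i)) p = coord (combination (A' i)) p"
      using echelon_coord_row[OF ech(1)] echelon_coord_row[OF ech(2)]
        echelon_pivot_coord[OF ech(1) i] echelon_pivot_coord[OF ech(2) i] c by simp
  qed
  show "A = A'"
  proof (intro ext)
    fix i j
    show "A i j = A' i j"
    proof (cases "i \<in> {1..k}")
      case True
      then show ?thesis
        using rows echelon_coord_row[OF ech(1)] echelon_coord_row[OF ech(2)] by metis
    next
      case False
      have "A i j = 0" "A' i j = 0"
        using False echelon_outside[OF ech(1)] echelon_outside[OF ech(2)] by blast+
      then show ?thesis
        by simp
    qed
  qed
qed

text \<open>The reduced vectors, one for each leading position of \<open>U\<close> and taken in decreasing order of position,
are the rows. They span \<open>U\<close> because each vector of \<open>U\<close> agrees at the pivots with a combination of them.\<close>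

lemma ex_echelon:
  assumes sub: "subspace U" and dim: "dim U = k"
  shows "\<exists>c A. is_echelon k n c A \<and> row_space scale b k n A = U"
proof -
  let ?P = "leading_positions U"
  \<comment> \<open>The number of rows is known to be the dimension only after the rows are seen to span.\<close>
  define m where "m = card ?P"
  define xs where "xs = sorted_list_of_set ?P"
  define c where "c i = (if i \<in> {1..m} then xs ! (m - i) else 0)" for i
  have xs: "sorted_wrt (<) xs" "length xs = m" "set xs = ?P"
    using finite_leading_positions by (auto simp: xs_def m_def)
  have c_dec: "c i > c i'" if "i \<in> {1..m}" "i' \<in> {1..m}" "i < i'" for i i'
    using that xs(2) sorted_wrt_nth_less[OF xs(1), of "m - i'" "m - i"] by (simp add: c_def)
  have c_P: "c i \<in> ?P" if "i \<in> {1..m}" for i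
    using that xs nth_mem[of "m - i" xs] by (auto simp: c_def)
  have P_n: "?P \<subseteq> {1..n}"
    using coord_nonzeroD by (auto simp: leading_positions_def leads_def)
  from ex_reduced_vector[OF sub] obtain w where w:
    "\<And>p. p \<in> ?P \<Longrightarrow> w p \<in> U \<and> coord (w p) p = 1 \<and> (\<forall>j>p. coord (w p) j = 0) \<and>
           (\<forall>p' \<in> ?P. p' \<noteq> p \<longrightarrow> coord (w p) p' = 0)"
    by metis
  define A where "A i j = (if i \<in> {1..m} then coord (w (c i)) j else 0)" for i j
  have ech: "is_echelon m n c A"
    unfolding is_echelon_def
  proof (intro conjI ballI allI impI)
    fix i i' assume i: "i \<in> {1..m}" "i' \<in> {1..m}" "i' \<noteq> i"
    then have "c i' \<noteq> c i"
      using c_dec by (metis less_irrefl linorder_neqE_nat)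
    then show "A i (c i') = 0"
      using w[OF c_P[OF i(1)]] c_P[OF i(2)] i(1) by (simp add: A_def)
  next
    fix i assume i: "i \<in> {1..m}"
    show "c i \<in> {1..n}"
      using c_P[OF i] P_n by blast
    show "A i (c i) = 1" and "\<And>j. j > c i \<Longrightarrow> A i j = 0"
      using w[OF c_P[OF i]] i by (simp_all add: A_def)
    show "\<And>i'. i' \<in> {1..m} \<Longrightarrow> i < i' \<Longrightarrow> c i > c i'"
      using c_dec i by blast
  next
    fix i j assume "\<not> (i \<in> {1..m} \<and> j \<in> {1..n})"
    then show "A i j = 0"
      using coord_outside[of j] by (simp add: A_def del: atLeastAtMost_iff)
  next
    fix i assume "i \<notin> {1..m}"
    then show "c i = 0"
      unfolding c_def by (rule if_not_P)
  qed
  have row: "combination (A i) = w (c i)" if "i \<in> {1..m}" for i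
    using that by (simp add: A_def[abs_def] combination_coord)
  let ?R = "row_space scale b m n A"
  have R_sub: "subspace ?R"
    by (simp add: row_space_eq)
  have R_U: "?R \<subseteq> U"
    unfolding row_space_eq using w c_P row by (intro span_minimal sub) auto
  have "c ` {1..m} = ?P"
  proof (rule card_subset_eq[OF finite_leading_positions])
    have "inj_on c {1..m}"
      using c_dec by (intro linorder_inj_onI') (metis less_irrefl)
    then show "card (c ` {1..m}) = card ?P"
      by (simp add: card_image m_def)
  qed (use c_P in auto)
  have U_R: "U \<subseteq> ?R"
  proof
    fix u assume u: "u \<in> U"
    let ?v = "\<Sum>i = 1..m. coord u (c i) *s combination (A i)"
    have v: "?v \<in> ?R"
      by (intro subspace_sum[OF R_sub] subspace_scale[OF R_sub])
        (auto simp: row_space_eq intro: span_base)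
    have "u = ?v"
    proof (rule eq_if_coord_leading_eq[OF sub u])
      show "?v \<in> U"
        using v R_U by blast
      fix p assume "p \<in> ?P"
      then obtain i where "i \<in> {1..m}" "p = c i"
        using \<open>c ` {1..m} = ?P\<close> by (metis imageE)
      then show "coord u p = coord ?v p"
        using echelon_coord_sum[OF ech] by simp
    qed
    then show "u \<in> ?R"
      using v by simp
  qed
  have "?R = U"
    using R_U U_R by blast
  moreover from this have "m = k"
    using dim_row_space[OF ech] dim by simp
  ultimately show ?thesis
    using ech by blast
qed

lemma echelon_form_row_space:
  assumes "is_echelon k n c A"
  shows "echelon_form scale b k n (row_space scale b k n A) = (c, A)"
  unfolding echelon_form_def
  by (rule the_equality) (use assms echelon_unique in auto)

lemma bij_betw_row_space:
  "bij_betw (\<lambda>(c, A). row_space scale b k n A) {(c, A). is_echelon k n c A}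
     {U. subspace U \<and> dim U = k}"
  unfolding bij_betw_def
proof
  show "inj_on (\<lambda>(c, A). row_space scale b k n A) {(c, A). is_echelon k n c A}"
    using echelon_unique by (auto simp: inj_on_def)
  have "subspace (row_space scale b k n A)" for A
    by (simp add: row_space_eq)
  then show "(\<lambda>(c, A). row_space scale b k n A) ` {(c, A). is_echelon k n c A} =
      {U. subspace U \<and> dim U = k}"
    using ex_echelon dim_row_space by fastforce
qed

end

section \<open>Deleting the first column\<close>

definition shift_pivots :: "nat \<Rightarrow> (nat \<Rightarrow> nat) \<Rightarrow> nat \<Rightarrow> nat" where
  "shift_pivots k c i = (if i \<in> {1..k} then Suc (c i) else 0)"

definition prepend_column :: "(nat \<Rightarrow> 'a) \<Rightarrow> (nat \<Rightarrow> nat \<Rightarrow> 'a) \<Rightarrow> nat \<Rightarrow> nat \<Rightarrow> 'a" where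
  "prepend_column v A i j = (if j = 1 then v i else A i (j - 1))"

definition drop_column :: "(nat \<Rightarrow> nat \<Rightarrow> 'a::zero) \<Rightarrow> nat \<Rightarrow> nat \<Rightarrow> 'a" where
  "drop_column A i j = (if j = 0 then 0 else A i (Suc j))"

text \<open>Column vectors range over extensional functions, which are undefined outside the index set, whereas
matrix entries vanish there; this mediates between the two conventions.\<close>

definition restrict_zero :: "nat set \<Rightarrow> (nat \<Rightarrow> 'a::zero) \<Rightarrow> nat \<Rightarrow> 'a" where
  "restrict_zero I v i = (if i \<in> I then v i else 0)"

lemma prepend_column_Suc: "1 \<le> j \<Longrightarrow> prepend_column v A i (Suc j) = A i j"
  by (simp add: prepend_column_def)

lemma prepend_column_1: "prepend_column v A i 1 = v i"
  by (simp add: prepend_column_def)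

lemma is_echelon_free_column:
  assumes E: "is_echelon k n c A"
  shows "is_echelon k (Suc n) (shift_pivots k c) (prepend_column (restrict_zero {1..k} v) A)"
    (is "is_echelon _ _ ?c ?A")
proof (rule echelonI)
  have A: "?A i (?c i') = A i (c i')" if "i' \<in> {1..k}" for i i'
    using that echelonD(2)[OF E that] by (simp add: shift_pivots_def prepend_column_Suc)
  show "?A i (?c i) = 1" if "i \<in> {1..k}" for i
    using A echelonD(5)[OF E] that by simp
  show "?A i (?c i') = 0" if "i \<in> {1..k}" "i' \<in> {1..k}" "i' \<noteq> i" for i i'
    using A echelonD(7)[OF E] that by simp
  show "?A i j = 0" if "i \<in> {1..k}" "?c i < j" for i j
    using that echelonD(2)[OF E that(1)] echelonD(6)[OF E that(1), of "j - 1"]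
    by (simp add: shift_pivots_def prepend_column_def)
  show "?A i j = 0" if out: "\<not> (i \<in> {1..k} \<and> j \<in> {1..Suc n})" for i j
  proof (cases "j = 1")
    case True
    then have "i \<notin> {1..k}"
      using out by simp
    then show ?thesis
      unfolding True prepend_column_1 restrict_zero_def by (rule if_not_P)
  next
    case False
    then have "A i (j - 1) = 0"
      using out by (intro echelon_outside[OF E]) auto
    then show ?thesis
      using False by (simp add: prepend_column_def)
  qed
qed (use echelonD(2,3,4)[OF E] in \<open>simp_all add: shift_pivots_def\<close>)

lemma is_echelon_pivot_column:
  assumes E: "is_echelon k n c A"
  shows "is_echelon (Suc k) (Suc n) (shift_pivots (Suc k) c)
           (prepend_column (restrict_zero {Suc k} (\<lambda>_. 1)) A)"
    (is "is_echelon _ _ ?c ?A")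
proof (rule echelonI)
  have last: "c (Suc k) = 0" "A (Suc k) j = 0" for j
    using echelonD(1)[OF E] echelon_outside[OF E] by simp_all
  have A: "?A i (?c i') = A i (c i')" if "i' \<in> {1..k}" for i i'
    using that echelonD(2)[OF E that] by (simp add: shift_pivots_def prepend_column_Suc)
  have A1: "?A i (?c (Suc k)) = (if i = Suc k then 1 else 0)" for i
    by (simp add: shift_pivots_def last prepend_column_def restrict_zero_def)
  have range: "i \<in> {1..Suc k} \<longleftrightarrow> i \<in> {1..k} \<or> i = Suc k" for i
    by auto
  show "?A i (?c i) = 1" if "i \<in> {1..Suc k}" for i
    using A A1 echelonD(5)[OF E] that range by metis
  show "?A i (?c i') = 0" if "i \<in> {1..Suc k}" "i' \<in> {1..Suc k}" "i' \<noteq> i" for i i'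
    using A[of i' i] A1[of i] last(2)[of "c i'"] echelonD(7)[OF E, of i i'] that range by metis
  show "?A i j = 0" if "i \<in> {1..Suc k}" "?c i < j" for i j
    using that last echelonD(2)[OF E, of i] echelonD(6)[OF E, of i "j - 1"]
    by (cases "i = Suc k") (simp_all add: shift_pivots_def prepend_column_def)
  show "?A i j = 0" if out: "\<not> (i \<in> {1..Suc k} \<and> j \<in> {1..Suc n})" for i j
  proof (cases "j = 1")
    case True
    then show ?thesis
      using out by (auto simp: prepend_column_1 restrict_zero_def)
  next
    case False
    then have "A i (j - 1) = 0"
      using out by (intro echelon_outside[OF E]) auto
    then show ?thesis
      using False by (simp add: prepend_column_def)
  qed
  show "?c i' < ?c i" if "i \<in> {1..Suc k}" "i' \<in> {1..Suc k}" "i < i'" for i i'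
    using that last echelonD(2)[OF E, of i] echelonD(4)[OF E, of i i']
    by (cases "i' = Suc k") (simp_all add: shift_pivots_def)
  show "?c i \<le> Suc n" if "i \<in> {1..Suc k}" for i
    using that last echelonD(3)[OF E, of i] by (cases "i = Suc k") (simp_all add: shift_pivots_def)
qed (simp_all add: shift_pivots_def)

text \<open>This serves both kinds of first column: \<open>k' = k\<close> if it contains no pivot, and \<open>k' = k - 1\<close> if it is the
pivot column of the last row. In the second case the last row becomes zero by itself, since its pivot
is its only nonzero entry.\<close>

lemma is_echelon_drop_column:
  assumes E: "is_echelon k (Suc n) c A" and kk: "k' \<le> k"
    and big: "\<And>i. i \<in> {1..k'} \<Longrightarrow> 1 < c i"
    and small: "\<And>i. i \<in> {1..k} \<Longrightarrow> i \<notin> {1..k'} \<Longrightarrow> c i = 1"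
  shows "is_echelon k' n (\<lambda>i. c i - 1) (drop_column A)"
proof (rule echelonI)
  have sub: "i \<in> {1..k}" if "i \<in> {1..k'}" for i
    using that kk by simp
  have A: "drop_column A i (c i' - 1) = A i (c i')" if "i' \<in> {1..k'}" for i i'
    using big[OF that] by (simp add: drop_column_def)
  show "drop_column A i (c i - 1) = 1" if "i \<in> {1..k'}" for i
    using A echelonD(5)[OF E] sub that by simp
  show "drop_column A i (c i' - 1) = 0" if "i \<in> {1..k'}" "i' \<in> {1..k'}" "i' \<noteq> i" for i i'
    using A echelonD(7)[OF E sub sub] that by simp
  show "drop_column A i j = 0" if "i \<in> {1..k'}" "c i - 1 < j" for i j
    using that echelonD(6)[OF E sub[OF that(1)], of "Suc j"] by (simp add: drop_column_def)
  show "drop_column A i j = 0" if out: "\<not> (i \<in> {1..k'} \<and> j \<in> {1..n})" for i j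
  proof (cases "i \<in> {1..k} \<and> j \<in> {1..n}")
    case True
    then have "A i (Suc j) = 0"
      using out small[of i] by (intro echelonD(6)[OF E]) auto
    then show ?thesis
      by (simp add: drop_column_def)
  next
    case False
    then have "j = 0 \<or> A i (Suc j) = 0"
      using echelon_outside[OF E, of i "Suc j"] by auto
    then show ?thesis
      by (auto simp: drop_column_def)
  qed
  show "c i - 1 = 0" if "i \<notin> {1..k'}" for i
    using that echelonD(1)[OF E, of i] small[of i] by (cases "i \<in> {1..k}") simp_all
  show "c i - 1 \<le> n" if "i \<in> {1..k'}" for i
    using echelonD(3)[OF E sub[OF that]] by simp
  show "1 \<le> c i - 1" if "i \<in> {1..k'}" for i
    using big[OF that] by simp
  show "c i' - 1 < c i - 1" if "i \<in> {1..k'}" "i' \<in> {1..k'}" "i < i'" for i i'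
    using echelonD(4)[OF E sub sub] that big[of i'] by fastforce
qed

lemma drop_prepend_column:
  assumes "is_echelon k n c A"
  shows "drop_column (prepend_column v A) = A"
proof (intro ext)
  fix i j
  show "drop_column (prepend_column v A) i j = A i j"
    using echelon_outside[OF assms, of i 0] by (simp add: drop_column_def prepend_column_def)
qed

lemma prepend_drop_column:
  assumes "is_echelon k n c A" and "\<And>i. v i = A i 1"
  shows "prepend_column v (drop_column A) = A"
proof (intro ext)
  fix i j
  show "prepend_column v (drop_column A) i j = A i j"
    using echelon_outside[OF assms(1), of i 0] assms(2)
    by (cases "j = 0") (auto simp: drop_column_def prepend_column_def)
qed

lemma pivots_drop_shift:
  assumes "\<And>i. i \<notin> {1..k} \<Longrightarrow> c i = 0"
  shows "(\<lambda>i. shift_pivots k c i - 1) = c"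
  using assms by (intro ext) (auto simp: shift_pivots_def)

lemma pivots_shift_drop:
  assumes "is_echelon k n c A"
  shows "shift_pivots k (\<lambda>i. c i - 1) = c"
  using echelonD(1,2)[OF assms] by (intro ext) (force simp: shift_pivots_def)


text \<open>Without a pivot in the first column, that column is arbitrary, independently of the rest.\<close>

lemma bij_betw_free_column:
  "bij_betw (\<lambda>((c, A), v). (shift_pivots k c, prepend_column (restrict_zero {1..k} v) A))
     (echelons k n \<times> PiE {1..k} (\<lambda>_. UNIV))
     {(c, A :: nat \<Rightarrow> nat \<Rightarrow> 'a::field) \<in> echelons k (Suc n). \<forall>i\<in>{1..k}. c i \<noteq> 1}"
    (is "bij_betw ?f ?X ?Y")
proof (rule bij_betw_byWitness[where
      f' = "\<lambda>(c, A). ((\<lambda>i. c i - 1, drop_column A), restrict (\<lambda>i. A i 1) {1..k})"])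
  let ?g = "\<lambda>(c, A :: nat \<Rightarrow> nat \<Rightarrow> 'a).
    ((\<lambda>i. c i - (1::nat), drop_column A), restrict (\<lambda>i. A i 1) {1..k})"
  have X: "\<exists>c A v. x = ((c, A), v) \<and> is_echelon k n c A \<and> v \<in> PiE {1..k} (\<lambda>_. UNIV)"
    if "x \<in> ?X" for x
    using that by (cases x) (auto simp: echelons_def)
  have Y: "\<exists>c A. y = (c, A) \<and> is_echelon k (Suc n) c A \<and> (\<forall>i\<in>{1..k}. c i \<noteq> 1)"
    if "y \<in> ?Y" for y
    using that by (cases y) (auto simp: echelons_def)
  show "\<forall>x\<in>?X. ?g (?f x) = x"
  proof
    fix x assume "x \<in> ?X"
    then obtain c A v where x: "x = ((c, A), v)" and E: "is_echelon k n c A"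
      and v: "v \<in> PiE {1..k} (\<lambda>_. UNIV)"
      using X by blast
    have "restrict (\<lambda>i. prepend_column (restrict_zero {1..k} v) A i 1) {1..k} = v"
      using v by (intro ext)
        (auto simp: prepend_column_1 restrict_zero_def restrict_def PiE_def extensional_def)
    then show "?g (?f x) = x"
      using drop_prepend_column[OF E] pivots_drop_shift[of k c, OF echelonD(1)[OF E]]
      by (simp add: x del: atLeastAtMost_iff)
  qed
  show "\<forall>y\<in>?Y. ?f (?g y) = y"
  proof
    fix y assume "y \<in> ?Y"
    then obtain c A where y: "y = (c, A)" and E: "is_echelon k (Suc n) c A"
      using Y by blast
    have "restrict_zero {1..k} (restrict (\<lambda>i. A i 1) {1..k}) i = A i 1" for i
      using echelon_outside[OF E, of i 1]
      by (cases "i \<in> {1..k}") (simp_all add: restrict_zero_def del: atLeastAtMost_iff)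
    then show "?f (?g y) = y"
      using prepend_drop_column[OF E] pivots_shift_drop[OF E] by (simp add: y)
  qed
  show "?f ` ?X \<subseteq> ?Y"
  proof (rule image_subsetI)
    fix x assume "x \<in> ?X"
    then obtain c A v where x: "x = ((c, A), v)" and E: "is_echelon k n c A"
      using X by blast
    have "\<forall>i\<in>{1..k}. shift_pivots k c i \<noteq> 1"
      using echelonD(2)[OF E] by (force simp: shift_pivots_def)
    then show "?f x \<in> ?Y"
      using is_echelon_free_column[OF E] by (simp add: x echelons_def)
  qed
  show "?g ` ?Y \<subseteq> ?X"
  proof (rule image_subsetI)
    fix y assume "y \<in> ?Y"
    then obtain c A where y: "y = (c, A)" and E: "is_echelon k (Suc n) c A"
      and ne: "\<forall>i\<in>{1..k}. c i \<noteq> 1"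
      using Y by blast
    have "1 < c i" if "i \<in> {1..k}" for i
      using ne echelonD(2)[OF E that] that by (metis le_neq_implies_less)
    then have "is_echelon k n (\<lambda>i. c i - 1) (drop_column A)"
      using is_echelon_drop_column[OF E order_refl] by blast
    then show "?g y \<in> ?X"
      by (simp add: y echelons_def)
  qed
qed

text \<open>The pivot in the first column necessarily belongs to the last row, and it forces the entire column.\<close>

lemma bij_betw_pivot_column:
  "bij_betw (\<lambda>(c, A). (shift_pivots (Suc k) c, prepend_column (restrict_zero {Suc k} (\<lambda>_. 1)) A))
     (echelons k n) {(c, A :: nat \<Rightarrow> nat \<Rightarrow> 'a::field) \<in> echelons (Suc k) (Suc n). c (Suc k) = 1}"
    (is "bij_betw ?f ?X ?Y")
proof (rule bij_betw_byWitness[where f' = "\<lambda>(c, A). (\<lambda>i. c i - 1, drop_column A)"])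
  let ?g = "\<lambda>(c, A :: nat \<Rightarrow> nat \<Rightarrow> 'a). (\<lambda>i. c i - (1::nat), drop_column A)"
  have X: "\<exists>c A. x = (c, A) \<and> is_echelon k n c A" if "x \<in> ?X" for x
    using that by (cases x) (auto simp: echelons_def)
  have Y: "\<exists>c A. y = (c, A) \<and> is_echelon (Suc k) (Suc n) c A \<and> c (Suc k) = 1" if "y \<in> ?Y" for y
    using that by (cases y) (auto simp: echelons_def)
  show "\<forall>x\<in>?X. ?g (?f x) = x"
  proof
    fix x assume "x \<in> ?X"
    then obtain c A where x: "x = (c, A)" and E: "is_echelon k n c A"
      using X by blast
    have "c i = 0" if "i \<notin> {1..Suc k}" for i
      using that by (intro echelonD(1)[OF E]) auto
    then show "?g (?f x) = x"
      using drop_prepend_column[OF E] pivots_drop_shift[of "Suc k" c] by (simp add: x)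
  qed
  show "\<forall>y\<in>?Y. ?f (?g y) = y"
  proof
    fix y assume "y \<in> ?Y"
    then obtain c A where y: "y = (c, A)" and E: "is_echelon (Suc k) (Suc n) c A"
      and 1: "c (Suc k) = 1"
      using Y by blast
    have "restrict_zero {Suc k} (\<lambda>_. 1) i = A i 1" for i
      using echelon_outside[OF E, of i 1] echelonD(5)[OF E, of "Suc k"]
        echelonD(7)[OF E, of i "Suc k"] 1
      by (cases "i \<in> {1..Suc k}") (auto simp: restrict_zero_def)
    then show "?f (?g y) = y"
      using prepend_drop_column[OF E] pivots_shift_drop[OF E] by (simp add: y)
  qed
  show "?f ` ?X \<subseteq> ?Y"
  proof (rule image_subsetI)
    fix x assume "x \<in> ?X"
    then obtain c A where x: "x = (c, A)" and E: "is_echelon k n c A"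
      using X by blast
    have "shift_pivots (Suc k) c (Suc k) = 1"
      using echelonD(1)[OF E, of "Suc k"] by (simp add: shift_pivots_def)
    then show "?f x \<in> ?Y"
      using is_echelon_pivot_column[OF E] by (simp add: x echelons_def)
  qed
  show "?g ` ?Y \<subseteq> ?X"
  proof (rule image_subsetI)
    fix y assume "y \<in> ?Y"
    then obtain c A where y: "y = (c, A)" and E: "is_echelon (Suc k) (Suc n) c A"
      and 1: "c (Suc k) = 1"
      using Y by blast
    have "is_echelon k n (\<lambda>i. c i - 1) (drop_column A)"
    proof (rule is_echelon_drop_column[OF E])
      show "1 < c i" if "i \<in> {1..k}" for i
        using echelonD(4)[OF E, of i "Suc k"] 1 that by simp
      show "c i = 1" if "i \<in> {1..Suc k}" "i \<notin> {1..k}" for i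
        using that 1 by (cases "i = Suc k") auto
    qed simp
    then show "?g y \<in> ?X"
      by (simp add: y echelons_def)
  qed
qed

section \<open>The statistic under deletion of the first column\<close>

text \<open>The statistic \<open>s\<close>, read off from the matrix instead of the subspace.\<close>

definition echelon_stat ::
  "('a \<Rightarrow> nat) \<Rightarrow> ('a \<Rightarrow> nat) \<Rightarrow> nat \<Rightarrow> nat \<Rightarrow> (nat \<Rightarrow> nat) \<Rightarrow> (nat \<Rightarrow> nat \<Rightarrow> 'a) \<Rightarrow> nat"
where
  "echelon_stat \<phi>0 \<phi>1 q k c A =
     (\<Sum>(i, j)\<in>param_positions k c.
        entry_value \<phi>0 \<phi>1 k c A i j * (q ^ (i + d_stat k c i j) - q ^ d_stat k c i j))"

abbreviation shift_position :: "nat \<times> nat \<Rightarrow> nat \<times> nat" where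
  "shift_position \<equiv> (\<lambda>(i, j). (i, Suc j))"

lemma finite_param_positions: "finite (param_positions k c)"
  by (rule finite_subset[of _ "SIGMA i:{1..k}. {..<c i}"]) (auto simp: param_positions_def)

lemma inj_shift_position: "inj_on shift_position S"
  by (auto simp: inj_on_def)

lemma sum_shift_position: "(\<Sum>x\<in>shift_position ` S. f x) = (\<Sum>(i, j)\<in>S. f (i, Suc j))"
  by (subst sum.reindex[OF inj_shift_position]) (simp add: case_prod_unfold)

lemma shift_pivots_image:
  "shift_pivots k c ` {1..k} = Suc ` c ` {1..k}"
  by (force simp: shift_pivots_def)

lemma shift_pivots_image_Suc:
  "c (Suc k) = 0 \<Longrightarrow> shift_pivots (Suc k) c ` {1..Suc k} = insert 1 (Suc ` c ` {1..k})"
  unfolding shift_pivots_image by (simp add: atLeastAtMostSuc_conv One_nat_def)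

lemma param_positions_free_column:
  assumes "\<And>i. i \<in> {1..k} \<Longrightarrow> 1 \<le> c i"
  shows "param_positions k (shift_pivots k c) =
           shift_position ` param_positions k c \<union> {1..k} \<times> {1}" (is "?L = ?R")
proof (intro set_eqI, clarify)
  fix i j
  have 0: "0 \<notin> c ` {1..k}"
    using assms by force
  show "(i, j) \<in> ?L \<longleftrightarrow> (i, j) \<in> ?R"
  proof (cases "j \<le> 1")
    case True
    then show ?thesis
      using assms[of i] 0
      by (auto simp: param_positions_def shift_pivots_image) (auto simp: shift_pivots_def One_nat_def)
  next
    case False
    then obtain m where m: "j = Suc m" "1 \<le> m"
      by (cases j) auto
    have "(i, j) \<in> ?R \<longleftrightarrow> (i, m) \<in> param_positions k c"
      using m by auto
    also have "\<dots> \<longleftrightarrow> (i, j) \<in> ?L"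
      using m by (auto simp: param_positions_def shift_pivots_image) (auto simp: shift_pivots_def)
    finally show ?thesis ..
  qed
qed

lemma param_positions_pivot_column:
  assumes "c (Suc k) = 0"
  shows "param_positions (Suc k) (shift_pivots (Suc k) c) = shift_position ` param_positions k c"
    (is "?L = ?R")
proof (intro set_eqI, clarify)
  fix i j
  have range: "i \<in> {1..Suc k} \<longleftrightarrow> i \<in> {1..k} \<or> i = Suc k"
    by auto
  show "(i, j) \<in> ?L \<longleftrightarrow> (i, j) \<in> ?R"
  proof (cases "j \<le> 1")
    case True
    then show ?thesis
      by (auto simp: param_positions_def shift_pivots_image_Suc[of c k, OF assms])
  next
    case False
    then obtain m where m: "j = Suc m" "1 \<le> m"
      by (cases j) auto
    have "(i, j) \<in> ?R \<longleftrightarrow> (i, m) \<in> param_positions k c"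
      using m by auto
    also have "\<dots> \<longleftrightarrow> (i, j) \<in> ?L"
      using m assms unfolding param_positions_def shift_pivots_image_Suc[of c k, OF assms] mem_Collect_eq
        case_prod_conv range
      by (auto simp: shift_pivots_def One_nat_def)
    finally show ?thesis ..
  qed
qed

text \<open>Guards the truncated subtraction in the definition of \<open>d\<close>.\<close>

lemma card_pivots_less:
  assumes "\<And>i. i \<in> {1..k} \<Longrightarrow> 1 \<le> c i" "1 \<le> j"
  shows "card {p \<in> c ` {1..k}. p < j} < j"
proof -
  have "{p \<in> c ` {1..k}. p < j} \<subseteq> {1..<j}"
    using assms by auto
  then have "card {p \<in> c ` {1..k}. p < j} \<le> card {1..<j}"
    by (intro card_mono) simp_all
  then show ?thesis
    using assms(2) by simp
qed

text \<open>The column index grows by one while the number of pivots to its left stays the same.\<close>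

lemma d_stat_free_column:
  assumes pos: "\<And>i. i \<in> {1..k} \<Longrightarrow> 1 \<le> c i" and j: "1 \<le> j"
  shows "d_stat k (shift_pivots k c) i (Suc j) = Suc (d_stat k c i j)"
proof -
  have "{p \<in> shift_pivots k c ` {1..k}. p < Suc j} = Suc ` {p \<in> c ` {1..k}. p < j}"
    unfolding shift_pivots_image by auto
  then have "card {p \<in> shift_pivots k c ` {1..k}. p < Suc j} = card {p \<in> c ` {1..k}. p < j}"
    by (simp add: card_image)
  then show ?thesis
    using card_pivots_less[of k c j, OF pos j] by (simp add: d_stat_def)
qed

text \<open>The number of rows, the column index and the number of pivots to the left all grow by one.\<close>

lemma d_stat_pivot_column:
  assumes pos: "\<And>i. i \<in> {1..k} \<Longrightarrow> 1 \<le> c i" and j: "1 \<le> j" and i: "i \<le> k"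
    and "c (Suc k) = 0"
  shows "d_stat (Suc k) (shift_pivots (Suc k) c) i (Suc j) = Suc (d_stat k c i j)"
proof -
  have "{p \<in> shift_pivots (Suc k) c ` {1..Suc k}. p < Suc j} =
      insert 1 (Suc ` {p \<in> c ` {1..k}. p < j})"
    unfolding shift_pivots_image_Suc[of c k, OF assms(4)] using j by auto
  moreover have "1 \<notin> Suc ` {p \<in> c ` {1..k}. p < j}"
    using pos by (force simp: One_nat_def)
  ultimately have "card {p \<in> shift_pivots (Suc k) c ` {1..Suc k}. p < Suc j} =
      Suc (card {p \<in> c ` {1..k}. p < j})"
    by (simp add: card_image)
  then show ?thesis
    using card_pivots_less[of k c j, OF pos j] i by (simp add: d_stat_def)
qed

lemma d_stat_first_column: "(\<And>i. i \<in> {1..k} \<Longrightarrow> 1 \<le> c i) \<Longrightarrow> d_stat k c i 1 = k - i"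
proof -
  assume "\<And>i. i \<in> {1..k} \<Longrightarrow> 1 \<le> c i"
  then have "{p \<in> c ` {1..k}. p < 1} = {}"
    by force
  then show ?thesis
    unfolding d_stat_def by (simp only: card.empty diff_zero add_diff_cancel_right')
qed

text \<open>Since \<open>d\<close> grows by one everywhere, every term is multiplied by \<open>q\<close>. The bijection used for an entry
is unchanged, because no column gains or loses a parametrization position.\<close>

lemma echelon_stat_pivot_column:
  assumes E: "is_echelon k n c A"
  shows "echelon_stat \<phi>0 \<phi>1 q (Suc k) (shift_pivots (Suc k) c) (prepend_column v A) =
           q * echelon_stat \<phi>0 \<phi>1 q k c A"
proof -
  have last: "c (Suc k) = 0"
    using echelonD(1)[OF E] by simp
  have positions: "(i, Suc j) \<in> shift_position ` param_positions k c \<longleftrightarrow>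
      (i, j) \<in> param_positions k c" for i j
    by auto
  have "echelon_stat \<phi>0 \<phi>1 q (Suc k) (shift_pivots (Suc k) c) (prepend_column v A) =
      (\<Sum>(i, j)\<in>param_positions k c. q * (entry_value \<phi>0 \<phi>1 k c A i j *
         (q ^ (i + d_stat k c i j) - q ^ d_stat k c i j)))"
    unfolding echelon_stat_def param_positions_pivot_column[of c k, OF last] sum_shift_position
  proof (intro sum.cong refl, clarify)
    fix i j assume ij: "(i, j) \<in> param_positions k c"
    then have "i \<le> k" "1 \<le> j"
      by (auto simp: param_positions_def)
    then have "d_stat (Suc k) (shift_pivots (Suc k) c) i (Suc j) = Suc (d_stat k c i j)"
      using d_stat_pivot_column echelonD(2)[OF E] last by blast
    moreover have "entry_value \<phi>0 \<phi>1 (Suc k) (shift_pivots (Suc k) c) (prepend_column v A) i (Suc j) =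
        entry_value \<phi>0 \<phi>1 k c A i j"
      unfolding entry_value_def param_positions_pivot_column[of c k, OF last] positions
        prepend_column_Suc[OF \<open>1 \<le> j\<close>] ..
    ultimately show "entry_value \<phi>0 \<phi>1 (Suc k) (shift_pivots (Suc k) c) (prepend_column v A) i (Suc j) *
        (q ^ (i + d_stat (Suc k) (shift_pivots (Suc k) c) i (Suc j)) -
         q ^ d_stat (Suc k) (shift_pivots (Suc k) c) i (Suc j)) =
        q * (entry_value \<phi>0 \<phi>1 k c A i j * (q ^ (i + d_stat k c i j) - q ^ d_stat k c i j))"
      by (simp add: diff_mult_distrib2 algebra_simps)
  qed
  then show ?thesis
    by (simp add: echelon_stat_def sum_distrib_left case_prod_unfold)
qed

text \<open>In the new column every row carries a parameter and \<open>d = k - i\<close>; the lowest position is in row \<open>k\<close>.\<close>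

lemma echelon_stat_free_column:
  assumes E: "is_echelon k n c A"
  shows "echelon_stat \<phi>0 \<phi>1 q k (shift_pivots k c) (prepend_column (restrict_zero {1..k} v) A) =
           q * echelon_stat \<phi>0 \<phi>1 q k c A +
           (\<Sum>i = 1..k. (if i = k then \<phi>1 (v i) else \<phi>0 (v i)) * (q ^ k - q ^ (k - i)))"
    (is "echelon_stat \<phi>0 \<phi>1 q k ?c ?A = _")
proof -
  note pos = echelonD(2)[OF E]
  have P: "param_positions k ?c = shift_position ` param_positions k c \<union> {1..k} \<times> {1}"
    using pos by (rule param_positions_free_column)
  let ?f = "\<lambda>(i, j). entry_value \<phi>0 \<phi>1 k ?c ?A i j * (q ^ (i + d_stat k ?c i j) - q ^ d_stat k ?c i j)"
  have disj: "shift_position ` param_positions k c \<inter> {1..k} \<times> {1} = {}"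
    by (auto simp: param_positions_def One_nat_def)
  have positions: "(i, Suc j) \<in> param_positions k ?c \<longleftrightarrow> (i, j) \<in> param_positions k c"
    if "1 \<le> j" for i j
    unfolding P using that by (auto simp: One_nat_def)
  have "echelon_stat \<phi>0 \<phi>1 q k ?c ?A =
      sum ?f (shift_position ` param_positions k c) + sum ?f ({1..k} \<times> {1})"
    unfolding echelon_stat_def P
    by (rule sum.union_disjoint) (use finite_param_positions disj in auto)
  also have "sum ?f (shift_position ` param_positions k c) =
      (\<Sum>(i, j)\<in>param_positions k c. q * (entry_value \<phi>0 \<phi>1 k c A i j *
         (q ^ (i + d_stat k c i j) - q ^ d_stat k c i j)))"
    unfolding sum_shift_position
  proof (intro sum.cong refl, clarify)
    fix i j assume "(i, j) \<in> param_positions k c"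
    then have "1 \<le> j"
      by (auto simp: param_positions_def)
    then have "d_stat k ?c i (Suc j) = Suc (d_stat k c i j)"
      using d_stat_free_column pos by blast
    moreover have "entry_value \<phi>0 \<phi>1 k ?c ?A i (Suc j) = entry_value \<phi>0 \<phi>1 k c A i j"
      unfolding entry_value_def positions[OF \<open>1 \<le> j\<close>] prepend_column_Suc[OF \<open>1 \<le> j\<close>] ..
    ultimately show "entry_value \<phi>0 \<phi>1 k ?c ?A i (Suc j) *
        (q ^ (i + d_stat k ?c i (Suc j)) - q ^ d_stat k ?c i (Suc j)) =
        q * (entry_value \<phi>0 \<phi>1 k c A i j * (q ^ (i + d_stat k c i j) - q ^ d_stat k c i j))"
      by (simp add: diff_mult_distrib2 algebra_simps)
  qed
  also have "\<dots> = q * echelon_stat \<phi>0 \<phi>1 q k c A"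
    by (simp add: echelon_stat_def sum_distrib_left case_prod_unfold)
  also have "sum ?f ({1..k} \<times> {1}) = (\<Sum>i = 1..k. ?f (i, 1))"
    by (simp add: sum.cartesian_product[symmetric])
  also have "\<dots> = (\<Sum>i = 1..k. (if i = k then \<phi>1 (v i) else \<phi>0 (v i)) * (q ^ k - q ^ (k - i)))"
  proof (intro sum.cong refl)
    fix i assume i: "i \<in> {1..k}"
    have "(i', 1) \<in> param_positions k ?c \<longleftrightarrow> i' \<in> {1..k}" for i'
      unfolding P by (auto simp: param_positions_def One_nat_def)
    then have "(\<forall>i'. (i', 1) \<in> param_positions k ?c \<longrightarrow> i' \<le> i) \<longleftrightarrow> i = k"
      using i by (metis atLeastAtMost_iff le_antisym order_refl order_trans)
    then have val: "entry_value \<phi>0 \<phi>1 k ?c ?A i 1 = (if i = k then \<phi>1 (v i) else \<phi>0 (v i))"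
      using i by (simp add: entry_value_def prepend_column_1 restrict_zero_def)
    have "d_stat k ?c i 1 = k - i"
      by (rule d_stat_first_column) (simp add: shift_pivots_def)
    then show "?f (i, 1) = (if i = k then \<phi>1 (v i) else \<phi>0 (v i)) * (q ^ k - q ^ (k - i))"
      using i val by simp
  qed
  finally show ?thesis .
qed

definition echelon_gf ::
  "('a::field \<Rightarrow> nat) \<Rightarrow> ('a \<Rightarrow> nat) \<Rightarrow> nat \<Rightarrow> nat \<Rightarrow> nat \<Rightarrow> 'f::field \<Rightarrow> 'f"
where
  "echelon_gf \<phi>0 \<phi>1 q n k x = (\<Sum>(c, A)\<in>echelons k n. x ^ echelon_stat \<phi>0 \<phi>1 q k c A)"

lemma sum_pivot_column:
  fixes \<phi>0 \<phi>1 :: "'a::field \<Rightarrow> nat"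
  shows "(\<Sum>(c, A) \<in> {(c, A) \<in> echelons (Suc k) (Suc n). c (Suc k) = 1}.
      x ^ echelon_stat \<phi>0 \<phi>1 q (Suc k) c A) = echelon_gf \<phi>0 \<phi>1 q n k (x ^ q)"
proof -
  have "echelon_gf \<phi>0 \<phi>1 q n k (x ^ q) = (\<Sum>y\<in>echelons k n.
      case (\<lambda>(c, A). (shift_pivots (Suc k) c, prepend_column (restrict_zero {Suc k} (\<lambda>_. 1)) A)) y
        of (c, A) \<Rightarrow> x ^ echelon_stat \<phi>0 \<phi>1 q (Suc k) c A)"
    unfolding echelon_gf_def
    by (intro sum.cong refl)
      (auto simp: echelons_def echelon_stat_pivot_column power_mult[symmetric])
  also have "\<dots> = (\<Sum>(c, A) \<in> {(c, A) \<in> echelons (Suc k) (Suc n). c (Suc k) = 1}.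
      x ^ echelon_stat \<phi>0 \<phi>1 q (Suc k) c A)"
    by (rule sum.reindex_bij_betw[OF bij_betw_pivot_column])
  finally show ?thesis ..
qed

text \<open>The entries of the free column contribute independently, so the sum over all columns is a product
over the rows.\<close>

lemma sum_free_column:
  fixes \<phi>0 \<phi>1 :: "'a::{field,finite} \<Rightarrow> nat"
  shows "(\<Sum>(c, A) \<in> {(c, A) \<in> echelons k (Suc n). \<forall>i\<in>{1..k}. c i \<noteq> 1}.
      x ^ echelon_stat \<phi>0 \<phi>1 q k c A) =
      (\<Prod>i = 1..k. \<Sum>a\<in>UNIV. x ^ ((if i = k then \<phi>1 a else \<phi>0 a) * (q ^ k - q ^ (k - i)))) *
      echelon_gf \<phi>0 \<phi>1 q n k (x ^ q)"
proof -
  let ?e = "\<lambda>i a. (if i = k then \<phi>1 a else \<phi>0 a) * (q ^ k - q ^ (k - i))"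
  have "(\<Sum>(c, A) \<in> {(c, A) \<in> echelons k (Suc n). \<forall>i\<in>{1..k}. c i \<noteq> 1}.
      x ^ echelon_stat \<phi>0 \<phi>1 q k c A) = (\<Sum>y \<in> echelons k n \<times> PiE {1..k} (\<lambda>_. UNIV).
      case (\<lambda>((c, A), v). (shift_pivots k c, prepend_column (restrict_zero {1..k} v) A)) y
        of (c, A) \<Rightarrow> x ^ echelon_stat \<phi>0 \<phi>1 q k c A)"
    by (rule sum.reindex_bij_betw[OF bij_betw_free_column, symmetric])
  also have "\<dots> = (\<Sum>((c, A), v) \<in> echelons k n \<times> PiE {1..k} (\<lambda>_. UNIV).
      (x ^ q) ^ echelon_stat \<phi>0 \<phi>1 q k c A * (\<Prod>i = 1..k. x ^ ?e i (v i)))"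
    by (intro sum.cong refl)
      (auto simp: echelons_def echelon_stat_free_column power_mult[symmetric] power_add power_sum)
  also have "\<dots> = echelon_gf \<phi>0 \<phi>1 q n k (x ^ q) *
      (\<Sum>v \<in> PiE {1..k} (\<lambda>_. UNIV). \<Prod>i = 1..k. x ^ ?e i (v i))"
    unfolding echelon_gf_def sum_product
    by (simp add: sum.cartesian_product case_prod_unfold)
  also have "(\<Sum>v \<in> PiE {1..k} (\<lambda>_. UNIV). \<Prod>i = 1..k. x ^ ?e i (v i)) =
      (\<Prod>i = 1..k. \<Sum>a\<in>UNIV. x ^ ?e i a)"
    by (rule prod_sum_PiE[symmetric]) simp_all
  finally show ?thesis
    by (simp add: mult.commute)
qed

text \<open>The first column is a pivot column or a free one; if any pivot is in it, it is the last one.\<close>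

lemma echelon_gf_Suc_Suc:
  fixes \<phi>0 \<phi>1 :: "'a::{field,finite} \<Rightarrow> nat"
  shows "echelon_gf \<phi>0 \<phi>1 q (Suc n) (Suc k) x = echelon_gf \<phi>0 \<phi>1 q n k (x ^ q) +
      (\<Prod>i = 1..Suc k. \<Sum>a\<in>UNIV.
         x ^ ((if i = Suc k then \<phi>1 a else \<phi>0 a) * (q ^ Suc k - q ^ (Suc k - i)))) *
      echelon_gf \<phi>0 \<phi>1 q n (Suc k) (x ^ q)"
proof -
  let ?w = "\<lambda>(c, A :: nat \<Rightarrow> nat \<Rightarrow> 'a). x ^ echelon_stat \<phi>0 \<phi>1 q (Suc k) c A"
  let ?P = "{(c, A :: nat \<Rightarrow> nat \<Rightarrow> 'a) \<in> echelons (Suc k) (Suc n). c (Suc k) = 1}"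
  let ?F = "{(c, A :: nat \<Rightarrow> nat \<Rightarrow> 'a) \<in> echelons (Suc k) (Suc n). \<forall>i\<in>{1..Suc k}. c i \<noteq> 1}"
  have "c (Suc k) = 1" if E: "is_echelon (Suc k) (Suc n) c A" and i: "i \<in> {1..Suc k}" "c i = 1"
    for c A and i
    using echelonD(2)[OF E, of "Suc k"] echelonD(4)[OF E i(1), of "Suc k"] i
    by (cases "i = Suc k") auto
  then have split: "echelons (Suc k) (Suc n) = ?P \<union> ?F"
    unfolding echelons_def by blast
  have fin: "finite ?P" "finite ?F"
    by (rule finite_subset[OF _ finite_echelons[of "Suc k" "Suc n"]]; blast)+
  have "echelon_gf \<phi>0 \<phi>1 q (Suc n) (Suc k) x = sum ?w (?P \<union> ?F)"
    unfolding echelon_gf_def by (rule sum.cong[OF split refl])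
  also have "\<dots> = sum ?w ?P + sum ?w ?F"
    by (rule sum.union_disjoint[OF fin]) auto
  finally show ?thesis
    unfolding sum_pivot_column sum_free_column .
qed

lemma echelon_gf_0:
  fixes \<phi>0 \<phi>1 :: "'a::field \<Rightarrow> nat"
  shows "echelon_gf \<phi>0 \<phi>1 q n 0 x = 1"
proof -
  have "is_echelon 0 n c A \<longleftrightarrow> c = (\<lambda>_. 0) \<and> A = (\<lambda>_ _. 0)" for c and A :: "nat \<Rightarrow> nat \<Rightarrow> 'a"
    by (simp add: is_echelon_def fun_eq_iff conj_commute)
  then have "echelons 0 n = {(\<lambda>_. 0, \<lambda>_ _. 0 :: 'a)}"
    by (auto simp: echelons_def)
  then show ?thesis
    by (simp add: echelon_gf_def echelon_stat_def param_positions_def)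
qed

lemma echelon_gf_0_Suc:
  fixes \<phi>0 \<phi>1 :: "'a::field \<Rightarrow> nat"
  shows "echelon_gf \<phi>0 \<phi>1 q 0 (Suc k) x = 0"
proof -
  have "echelons (Suc k) 0 = ({} :: ((nat \<Rightarrow> nat) \<times> (nat \<Rightarrow> nat \<Rightarrow> 'a)) set)"
    using echelonD(2,3)[of "Suc k" 0 _ _ "Suc k"] by (fastforce simp: echelons_def)
  then show ?thesis
    by (simp add: echelon_gf_def)
qed

section \<open>The recursion of the (q,t)-binomial\<close>

text \<open>The \<open>(q,t)\<close>-binomial evaluated at a field element. The recursion replaces \<open>x\<close> by \<open>x ^ q\<close>, which
cannot be said of the fixed variable \<open>t\<close>.\<close>

definition qt_binomial_at :: "nat \<Rightarrow> nat \<Rightarrow> nat \<Rightarrow> 'f::field \<Rightarrow> 'f" where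
  "qt_binomial_at q n k x = (\<Prod>i<k. (1 - x ^ (q ^ n - q ^ i)) / (1 - x ^ (q ^ k - q ^ i)))"

lemma qt_binomial_eq_qt_binomial_at: "qt_binomial q n k = qt_binomial_at q n k tvar"
  unfolding qt_binomial_def qt_binomial_at_def
  by (rule prod.reindex_bij_witness[where i = Suc and j = "\<lambda>i. i - 1"]) auto

text \<open>The numerator contains the factor \<open>1 - x ^ (q ^ n - q ^ n)\<close>.\<close>

lemma qt_binomial_at_eq_0: "n < k \<Longrightarrow> qt_binomial_at q n k x = 0"
  unfolding qt_binomial_at_def by (rule prod_zero) (auto intro!: bexI[of _ n])

text \<open>With \<open>N m j x\<close> for the numerator, the denominator is \<open>N j j x\<close>. Splitting off the factor for \<open>i = 0\<close>
expresses \<open>N (Suc m) (Suc j) x\<close> by \<open>N m j (x ^ q)\<close>. The quotient of \<open>N (Suc k) (Suc k) (x ^ q)\<close> by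
\<open>N (Suc k) (Suc k) x\<close> has the factors \<open>(1 - y ^ q) / (1 - y)\<close> with \<open>y = x ^ (q ^ Suc k - q ^ i)\<close>, which
are geometric sums. No denominator vanishes because no positive power of \<open>x\<close> is 1.\<close>

lemma qt_binomial_at_Suc_Suc:
  fixes x :: "'f::field"
  assumes q: "1 < q" and x: "\<And>m. 0 < m \<Longrightarrow> x ^ m \<noteq> 1"
  shows "qt_binomial_at q (Suc n) (Suc k) x = qt_binomial_at q n k (x ^ q) +
      x ^ (q ^ Suc k - 1) * (\<Prod>i<Suc k. \<Sum>v<q. (x ^ (q ^ Suc k - q ^ i)) ^ v) *
      qt_binomial_at q n (Suc k) (x ^ q)"
proof (cases "n < k")
  case True
  then show ?thesis
    by (simp add: qt_binomial_at_eq_0)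
next
  case False
  then have kn: "k \<le> n"
    by simp
  define N where "N m j y = (\<Prod>i<j. 1 - y ^ (q ^ m - q ^ i))" for m j and y :: 'f
  have quotient: "qt_binomial_at q m j y = N m j y / N j j y" for m j and y :: 'f
    by (simp add: qt_binomial_at_def N_def prod_dividef)
  \<comment> \<open>This also holds where the differences are truncated to 0.\<close>
  have frob: "(x ^ q) ^ (q ^ m - q ^ i) = x ^ (q ^ Suc m - q ^ Suc i)" for m i
    by (simp add: power_mult[symmetric] diff_mult_distrib2)
  have nz: "1 - x ^ (q ^ Suc j - q ^ i) \<noteq> 0" if "i \<le> j" for i j
  proof -
    have "q ^ i < q ^ Suc j"
      using that q by (intro power_strict_increasing) auto
    then show ?thesis
      using x[of "q ^ Suc j - q ^ i"] by simp
  qed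
  have N_Suc: "N (Suc m) (Suc j) x = (1 - x ^ (q ^ Suc m - 1)) * N m j (x ^ q)" for m j
    unfolding N_def prod.lessThan_Suc_shift frob by simp
  let ?D = "1 - x ^ (q ^ Suc k - 1)"
  let ?X = "x ^ (q ^ Suc k - 1)"
  let ?G = "\<Prod>i<Suc k. \<Sum>v<q. (x ^ (q ^ Suc k - q ^ i)) ^ v"
  have D: "?D \<noteq> 0"
    using nz[of 0 k] by simp
  have Nk: "N k k (x ^ q) \<noteq> 0"
    unfolding N_def frob using nz by (auto simp: Suc_le_eq simp del: power_Suc)
  have NSk: "N (Suc k) (Suc k) (x ^ q) \<noteq> 0"
    unfolding N_def frob using nz by (auto simp: less_Suc_eq_le simp del: power_Suc)
  have G: "?G * (?D * N k k (x ^ q)) = N (Suc k) (Suc k) (x ^ q)"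
  proof -
    have "?G * N (Suc k) (Suc k) x =
        (\<Prod>i<Suc k. (\<Sum>v<q. (x ^ (q ^ Suc k - q ^ i)) ^ v) * (1 - x ^ (q ^ Suc k - q ^ i)))"
      unfolding N_def by (rule prod.distrib[symmetric])
    also have "\<dots> = N (Suc k) (Suc k) (x ^ q)"
      unfolding N_def
    proof (intro prod.cong refl)
      fix i
      let ?y = "x ^ (q ^ Suc k - q ^ i)"
      have "(\<Sum>v<q. ?y ^ v) * (1 - ?y) = 1 - ?y ^ q"
        by (simp add: one_diff_power_eq mult.commute)
      also have "?y ^ q = (x ^ q) ^ (q ^ Suc k - q ^ i)"
        by (simp only: power_mult[symmetric] mult.commute)
      finally show "(\<Sum>v<q. ?y ^ v) * (1 - ?y) = 1 - (x ^ q) ^ (q ^ Suc k - q ^ i)" .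
    qed
    finally show ?thesis
      by (simp only: N_Suc)
  qed
  \<comment> \<open>The splitting of the factor for \<open>i = 0\<close> into the two summands of the recursion.\<close>
  have "q ^ Suc n - 1 = (q ^ Suc k - 1) + (q ^ Suc n - q ^ Suc k)"
    using power_increasing[of "Suc k" "Suc n" q] one_le_power[of q "Suc k"] kn q
    by (simp del: power_Suc)
  then have split: "x ^ (q ^ Suc n - 1) = ?X * (x ^ q) ^ (q ^ n - q ^ k)"
    by (simp only: frob power_add)
  have "N (Suc n) (Suc k) x = ?D * N n k (x ^ q) + ?X * N n (Suc k) (x ^ q)"
    unfolding N_Suc split by (simp add: N_def algebra_simps)
  then have "qt_binomial_at q (Suc n) (Suc k) x =
      (?D * N n k (x ^ q) + ?X * N n (Suc k) (x ^ q)) / (?D * N k k (x ^ q))"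
    by (simp only: quotient N_Suc[of k k])
  also have "\<dots> = N n k (x ^ q) / N k k (x ^ q) +
      ?X * (?G * N n (Suc k) (x ^ q) / N (Suc k) (Suc k) (x ^ q))"
  proof -
    have "N n (Suc k) (x ^ q) / (?D * N k k (x ^ q)) =
        ?G * N n (Suc k) (x ^ q) / N (Suc k) (Suc k) (x ^ q)"
      using D Nk NSk unfolding G[symmetric] by simp
    from this[symmetric] show ?thesis
      using D by (simp only: times_divide_eq_right add_divide_distrib
          mult_divide_mult_cancel_left simp_thms)
  qed
  finally show ?thesis
    by (simp add: quotient mult.assoc)
qed

section \<open>Equality of the two sides\<close>

lemma sum_powers_shift: "(\<Sum>v = 1..q. y ^ v) = y * (\<Sum>v<q. y ^ v)" for y :: "'f::field"
proof -
  have "(\<Sum>v = 1..q. y ^ v) = (\<Sum>v<q. y ^ Suc v)"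
    by (rule sum.reindex_bij_witness[where i = Suc and j = "\<lambda>i. i - 1"]) auto
  then show ?thesis
    by (simp add: sum_distrib_left)
qed

lemma sum_values_0:
  assumes "bij_betw \<phi>0 (UNIV :: 'a set) {0..q - 1}" "0 < q"
  shows "(\<Sum>a\<in>UNIV. y ^ (\<phi>0 a * e)) = (\<Sum>v<q. (y ^ e) ^ v :: 'f::field)"
proof -
  have "(\<Sum>a\<in>UNIV. y ^ (\<phi>0 a * e)) = (\<Sum>v \<in> {0..q - 1}. (y ^ e) ^ v)"
    using sum.reindex_bij_betw[OF assms(1), of "\<lambda>v. (y ^ e) ^ v"]
    by (simp add: power_mult[symmetric] mult.commute)
  also have "{0..q - 1} = {..<q}"
    using assms(2) by auto
  finally show ?thesis .
qed

lemma sum_values_1: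
  assumes "bij_betw \<phi>1 (UNIV :: 'a set) {1..q}"
  shows "(\<Sum>a\<in>UNIV. y ^ (\<phi>1 a * e)) = y ^ e * (\<Sum>v<q. (y ^ e) ^ v :: 'f::field)"
  using sum.reindex_bij_betw[OF assms, of "\<lambda>v. (y ^ e) ^ v"] sum_powers_shift[of "y ^ e" q]
  by (simp add: power_mult[symmetric] mult.commute[of e])

text \<open>The values 1 to \<open>q\<close> at the lowest position, instead of 0 to \<open>q - 1\<close>, cause the additional factor.\<close>

lemma free_column_product:
  fixes x :: "'f::field"
  assumes "bij_betw \<phi>0 (UNIV :: 'a set) {0..q - 1}" "bij_betw \<phi>1 (UNIV :: 'a set) {1..q}" "0 < q"
  shows "(\<Prod>i = 1..Suc k. \<Sum>a\<in>UNIV.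
         x ^ ((if i = Suc k then \<phi>1 a else \<phi>0 a) * (q ^ Suc k - q ^ (Suc k - i)))) =
      x ^ (q ^ Suc k - 1) * (\<Prod>i<Suc k. \<Sum>v<q. (x ^ (q ^ Suc k - q ^ i)) ^ v)"
proof -
  let ?e = "\<lambda>i. q ^ Suc k - q ^ i"
  have "(\<Prod>i = 1..Suc k. \<Sum>a\<in>UNIV. x ^ ((if i = Suc k then \<phi>1 a else \<phi>0 a) * ?e (Suc k - i))) =
      (\<Prod>i = 1..Suc k. (if i = Suc k then x ^ ?e 0 else 1) * (\<Sum>v<q. (x ^ ?e (Suc k - i)) ^ v))"
    by (intro prod.cong refl) (simp add: sum_values_0[OF assms(1,3)] sum_values_1[OF assms(2)])
  also have "\<dots> = x ^ ?e 0 * (\<Prod>i = 1..Suc k. \<Sum>v<q. (x ^ ?e (Suc k - i)) ^ v)"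
    by (simp add: prod.distrib prod.delta)
  also have "(\<Prod>i = 1..Suc k. \<Sum>v<q. (x ^ ?e (Suc k - i)) ^ v) =
      (\<Prod>i<Suc k. \<Sum>v<q. (x ^ ?e i) ^ v)"
    by (rule prod.reindex_bij_witness[where i = "\<lambda>i. Suc k - i" and j = "\<lambda>i. Suc k - i"]) auto
  finally show ?thesis
    by simp
qed

text \<open>The condition that no positive power is 1 passes from \<open>x\<close> to \<open>x ^ q\<close>, so the induction over \<open>n\<close> goes through when
\<open>x\<close> and \<open>k\<close> vary.\<close>

lemma echelon_gf_eq_qt_binomial_at:
  fixes \<phi>0 \<phi>1 :: "'a::{field,finite} \<Rightarrow> nat" and x :: "'f::field"
  assumes "bij_betw \<phi>0 UNIV {0..q - 1}" "bij_betw \<phi>1 UNIV {1..q}" and q: "1 < q"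
    and "\<And>m. 0 < m \<Longrightarrow> x ^ m \<noteq> 1"
  shows "echelon_gf \<phi>0 \<phi>1 q n k x = qt_binomial_at q n k x"
  using assms(4)
proof (induction n arbitrary: k x)
  case 0
  show ?case
  proof (cases k)
    case 0
    then show ?thesis
      by (simp add: echelon_gf_0 qt_binomial_at_def)
  next
    case (Suc k')
    then show ?thesis
      by (simp add: echelon_gf_0_Suc qt_binomial_at_eq_0)
  qed
next
  case (Suc n)
  show ?case
  proof (cases k)
    case 0
    then show ?thesis
      by (simp add: echelon_gf_0 qt_binomial_at_def)
  next
    case (Suc k')
    have "(x ^ q) ^ m \<noteq> 1" if "0 < m" for m
      using Suc.prems[of "q * m"] that q by (simp add: power_mult)
    then have IH: "echelon_gf \<phi>0 \<phi>1 q n j (x ^ q) = qt_binomial_at q n j (x ^ q)" for j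
      by (rule Suc.IH)
    have "0 < q"
      using q by simp
    then show ?thesis
      unfolding \<open>k = Suc k'\<close> echelon_gf_Suc_Suc IH
      by (subst qt_binomial_at_Suc_Suc[OF q Suc.prems]) (simp_all only: free_column_product[OF assms(1,2)])
  qed
qed

text \<open>Otherwise the polynomials \<open>t ^ m\<close> and 1 would be equal, but they differ at 0.\<close>

lemma tvar_power_neq_1:
  assumes "0 < m"
  shows "tvar ^ m \<noteq> 1"
proof
  have "tvar ^ m = Fract ([:0, 1:] ^ m) 1"
    by (induction m) (simp_all add: tvar_def One_fract_def)
  moreover assume "tvar ^ m = 1"
  ultimately have "[:0, 1:] ^ m = (1 :: rat poly)"
    by (simp add: One_fract_def eq_fract)
  then have "poly ([:0, 1:] ^ m) 0 = (1 :: rat)"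
    by simp
  then show False
    using assms by (simp add: zero_power)
qed

theorem theorem5p9:
  fixes scale :: "'a::{field,finite} \<Rightarrow> 'v::ab_group_add \<Rightarrow> 'v"
    and b :: "nat \<Rightarrow> 'v"
    and \<phi>0 \<phi>1 :: "'a \<Rightarrow> nat"
    and q n k :: nat
  assumes "q = CARD('a)"
    and "vector_space scale"
    and "inj_on b {1..n}"
    and "\<not> module.dependent scale (b ` {1..n})"
    and "module.span scale (b ` {1..n}) = UNIV"
    and "k \<le> n"
    and "bij_betw \<phi>0 UNIV {0..q - 1}"
    and "bij_betw \<phi>1 UNIV {1..q}"
  shows "qt_binomial q n k =
    (\<Sum>U | module.subspace scale U \<and> vector_space.dim scale U = k.
       tvar ^ s_stat scale b \<phi>0 \<phi>1 k n U)"
proof -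
  interpret vector_space scale
    by fact
  interpret ordered_basis scale b n
    by unfold_locales (use assms in auto)
  have "card {0, 1 :: 'a} \<le> CARD('a)"
    by (intro card_mono) auto
  then have q: "1 < q"
    using assms(1) by simp
  have "(\<Sum>U | subspace U \<and> dim U = k. tvar ^ s_stat scale b \<phi>0 \<phi>1 k n U) =
      (\<Sum>(c, A)\<in>echelons k n. tvar ^ s_stat scale b \<phi>0 \<phi>1 k n (row_space scale b k n A))"
    unfolding echelons_def sum.reindex_bij_betw[OF bij_betw_row_space, symmetric]
    by (simp add: case_prod_unfold)
  also have "\<dots> = echelon_gf \<phi>0 \<phi>1 q n k tvar"
    unfolding echelon_gf_def
    by (intro sum.cong refl)
      (auto simp: echelons_def s_stat_def echelon_form_row_space echelon_stat_def assms(1)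
        Let_def)
  also have "\<dots> = qt_binomial_at q n k tvar"
    using assms(7,8) q tvar_power_neq_1 by (rule echelon_gf_eq_qt_binomial_at)
  finally show ?thesis
    by (simp add: qt_binomial_eq_qt_binomial_at)
qed

end
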